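(* Let $S\subseteq R$ be an $m$-system of a ring $R$ with identity, and let $P$ be an ideal of $R$ such that $P\cap S=\emptyset$. Then the following statements are equivalent. (1) $P$ is an almost right $S$-prime ideal. (2) There exists $s\in S$ such that for all $a,b\in R$ with $aRb\subseteq P$ and $aRb\not\subseteq P^2$, we have $a\langle s\rangle\subseteq P$ or $b\langle s\rangle\subseteq P$.
   Context: Rings are associative and not necessarily commutative; ideals are two-sided. An $m$-system of $R$ is a nonempty subset $S\subseteq R$ such that for all $a,b\in S$ there is $r\in R$ with $arb\in S$. $\langle s\rangle$ denotes the two-sided ideal of $R$ generated by $s$. For ideals $A,B$, $AB$ is the additive subgroup generated by products $ab$ ($a\in A,b\in B$), and $P^2=PP$. An ideal $P$ of $R$ with $P\cap S=\emptyset$ is an almost right $S$-prime ideal if there is an element $s\in S$ (with which $P$ is then said to be associated) such that for all ideals $A,B$ of $R$ with $AB\subseteq P$ and $AB\not\subseteq P^2$, either $A\langle s\rangle\subseteq P$ or $B\langle s\rangle\subseteq P$. *)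

theory Defs
  imports "HOL-Algebra.Ideal_Product"
begin

definition m_system :: "('a, 'b) ring_scheme \<Rightarrow> 'a set \<Rightarrow> bool" where
  "m_system R S \<longleftrightarrow>
     S \<subseteq> carrier R \<and> S \<noteq> {} \<and>
     (\<forall>a\<in>S. \<forall>b\<in>S. \<exists>r\<in>carrier R. a \<otimes>\<^bsub>R\<^esub> r \<otimes>\<^bsub>R\<^esub> b \<in> S)"

text \<open>
  The two-sided ideal generated by \<open>s\<close> is \<open>Idl {s}\<close>; the library's \<open>PIdl s\<close> is \<open>{x \<otimes> s | x \<in> R}\<close>,
  in general only a left ideal. The sums of products in \<open>ideal_prod\<close> form the additive subgroup
  generated by the products, because its arguments here are ideals.
\<close>

definition almost_right_S_prime ::
    "('a, 'b) ring_scheme \<Rightarrow> 'a set \<Rightarrow> 'a set \<Rightarrow> bool" where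
  "almost_right_S_prime R S P \<longleftrightarrow>
     ideal P R \<and> P \<inter> S = {} \<and>
     (\<exists>s\<in>S. \<forall>A B. ideal A R \<longrightarrow> ideal B R \<longrightarrow>
        A \<cdot>\<^bsub>R\<^esub> B \<subseteq> P \<longrightarrow> \<not> A \<cdot>\<^bsub>R\<^esub> B \<subseteq> P \<cdot>\<^bsub>R\<^esub> P \<longrightarrow>
        A \<cdot>\<^bsub>R\<^esub> (Idl\<^bsub>R\<^esub> {s}) \<subseteq> P \<or> B \<cdot>\<^bsub>R\<^esub> (Idl\<^bsub>R\<^esub> {s}) \<subseteq> P)"

text \<open>
  The elementwise products \<open>a I\<close> and \<open>a R b\<close> are written with the coset operations
  \<open>a <# I\<close> and \<open>H #> b\<close>, which for a ring record refer to the ring multiplication.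
\<close>

end

theory Submission
  imports Defs
begin

text \<open>
  Both directions use the same element \<open>s\<close>. From ideals to elements, \<open>aRb \<subseteq> P\<close> forces the product
  of the ideals generated by \<open>a\<close> and \<open>b\<close> into \<open>P\<close>, so the condition on ideals applies to these two.

  From elements to ideals, let \<open>H\<close> be the additive group of all \<open>x\<close> with \<open>x\<langle>s\<rangle> \<subseteq> P\<close>, and suppose that
  \<open>AB \<subseteq> P\<close> while neither \<open>A\<close> nor \<open>B\<close> lies in \<open>H\<close>. The condition on elements then says that
  \<open>xRy \<subseteq> P\<^sup>2\<close> whenever \<open>x \<in> A\<close> and \<open>y \<in> B\<close> are both outside \<open>H\<close>. The difficulty is that the
  witnesses for \<open>AB \<not>\<subseteq> P\<^sup>2\<close> may well lie in \<open>H\<close>. It disappears because no group is the union of two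
  proper subgroups (\<open>additive_subgroup_not_union\<close>): for fixed \<open>y\<close>, the \<open>x\<close> with \<open>xRy \<subseteq> P\<^sup>2\<close> form a
  group that together with \<open>H\<close> covers \<open>A\<close>, hence already contains \<open>A\<close>; the same argument in the
  second variable then gives \<open>xRy \<subseteq> P\<^sup>2\<close> for all \<open>x \<in> A\<close> and \<open>y \<in> B\<close>, so \<open>AB \<subseteq> P\<^sup>2\<close>.
\<close>

definition left_transporter :: "('a, 'b) ring_scheme \<Rightarrow> 'a set \<Rightarrow> 'a set \<Rightarrow> 'a set" where
  "left_transporter R T Q = {x \<in> carrier R. \<forall>t\<in>T. x \<otimes>\<^bsub>R\<^esub> t \<in> Q}"

definition right_transporter :: "('a, 'b) ring_scheme \<Rightarrow> 'a set \<Rightarrow> 'a set \<Rightarrow> 'a set" where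
  "right_transporter R T Q = {x \<in> carrier R. \<forall>t\<in>T. t \<otimes>\<^bsub>R\<^esub> x \<in> Q}"

lemma (in abelian_group) additive_subgroup_not_union:
  assumes "additive_subgroup A G" "additive_subgroup H G" "additive_subgroup K G"
    and cover: "A \<subseteq> H \<union> K" and "\<not> A \<subseteq> H"
  shows "A \<subseteq> K"
proof
  interpret A: additive_subgroup A G by fact
  interpret H: additive_subgroup H G by fact
  interpret K: additive_subgroup K G by fact
  fix x assume x: "x \<in> A"
  obtain a where a: "a \<in> A" "a \<notin> H" using assms(5) by blast
  have carr: "x \<in> carrier G" "a \<in> carrier G" using x a A.a_subset by auto
  show "x \<in> K"
  proof (rule ccontr)
    assume "x \<notin> K"
    then have xH: "x \<in> H" and aK: "a \<in> K" using x a cover by auto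
    \<comment> \<open>The element \<open>x + a\<close> of \<open>A\<close> can lie in neither subgroup.\<close>
    have "x \<oplus> a \<in> H \<or> x \<oplus> a \<in> K" using x a cover by blast
    moreover have "x \<oplus> a \<notin> H"
    proof
      assume "x \<oplus> a \<in> H"
      then have "\<ominus> x \<oplus> (x \<oplus> a) \<in> H" using xH by blast
      then show False using a carr by (simp add: r_neg1)
    qed
    moreover have "x \<oplus> a \<notin> K"
    proof
      assume "x \<oplus> a \<in> K"
      then have "(x \<oplus> a) \<oplus> \<ominus> a \<in> K" using aK by blast
      then show False using \<open>x \<notin> K\<close> carr by (simp add: a_assoc r_neg)
    qed
    ultimately show False by blast
  qed
qed

lemma (in ring) additive_subgroup_left_transporter:
  assumes "T \<subseteq> carrier R" "additive_subgroup Q R"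
  shows "additive_subgroup (left_transporter R T Q) R"
proof (rule additive_subgroupI, rule add.subgroupI)
  interpret Q: additive_subgroup Q R by fact
  show "left_transporter R T Q \<subseteq> carrier R"
    by (auto simp: left_transporter_def)
  have "\<zero> \<in> left_transporter R T Q"
    using assms(1) by (auto simp: left_transporter_def)
  then show "left_transporter R T Q \<noteq> {}" by blast
  show "\<ominus> x \<in> left_transporter R T Q" if "x \<in> left_transporter R T Q" for x
    using that assms(1) by (auto simp: left_transporter_def l_minus subset_iff)
  show "x \<oplus> y \<in> left_transporter R T Q"
    if "x \<in> left_transporter R T Q" "y \<in> left_transporter R T Q" for x y
    using that assms(1) by (auto simp: left_transporter_def l_distr subset_iff)
qed

lemma (in ring) additive_subgroup_right_transporter:
  assumes "T \<subseteq> carrier R" "additive_subgroup Q R"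
  shows "additive_subgroup (right_transporter R T Q) R"
proof (rule additive_subgroupI, rule add.subgroupI)
  interpret Q: additive_subgroup Q R by fact
  show "right_transporter R T Q \<subseteq> carrier R"
    by (auto simp: right_transporter_def)
  have "\<zero> \<in> right_transporter R T Q"
    using assms(1) by (auto simp: right_transporter_def)
  then show "right_transporter R T Q \<noteq> {}" by blast
  show "\<ominus> x \<in> right_transporter R T Q" if "x \<in> right_transporter R T Q" for x
    using that assms(1) by (auto simp: right_transporter_def r_minus subset_iff)
  show "x \<oplus> y \<in> right_transporter R T Q"
    if "x \<in> right_transporter R T Q" "y \<in> right_transporter R T Q" for x y
    using that assms(1) by (auto simp: right_transporter_def r_distr subset_iff)
qed

text \<open>
  Closure under right multiplication comes from moving the factor across: \<open>(xu)t = x(ut)\<close>. This is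
  why \<open>T\<close> has to absorb multiplication from the left.
\<close>

lemma (in ring) ideal_left_transporter:
  assumes T: "T \<subseteq> carrier R" "\<And>u t. u \<in> carrier R \<Longrightarrow> t \<in> T \<Longrightarrow> u \<otimes> t \<in> T"
    and Q: "ideal Q R"
  shows "ideal (left_transporter R T Q) R"
proof (rule idealI)
  interpret Q: ideal Q R by fact
  show "subgroup (left_transporter R T Q) (add_monoid R)"
    using additive_subgroup_left_transporter[OF T(1)] Q.additive_subgroup_axioms
    by (blast intro: additive_subgroup.a_subgroup)
  fix x u assume x: "x \<in> left_transporter R T Q" and u: "u \<in> carrier R"
  show "u \<otimes> x \<in> left_transporter R T Q"
    using x u T(1) by (auto simp: left_transporter_def m_assoc subset_iff Q.I_l_closed)
  show "x \<otimes> u \<in> left_transporter R T Q"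
    using x u T by (auto simp: left_transporter_def m_assoc subset_iff)
qed (rule ring_axioms)

lemma (in ring) ideal_right_transporter:
  assumes T: "T \<subseteq> carrier R" "\<And>u t. u \<in> carrier R \<Longrightarrow> t \<in> T \<Longrightarrow> t \<otimes> u \<in> T"
    and Q: "ideal Q R"
  shows "ideal (right_transporter R T Q) R"
proof (rule idealI)
  interpret Q: ideal Q R by fact
  show "subgroup (right_transporter R T Q) (add_monoid R)"
    using additive_subgroup_right_transporter[OF T(1)] Q.additive_subgroup_axioms
    by (blast intro: additive_subgroup.a_subgroup)
  fix x u assume x: "x \<in> right_transporter R T Q" and u: "u \<in> carrier R"
  show "x \<otimes> u \<in> right_transporter R T Q"
    using x u T(1)
    by (auto simp: right_transporter_def m_assoc[symmetric] subset_iff Q.I_r_closed)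
  show "u \<otimes> x \<in> right_transporter R T Q"
    using x u T by (auto simp: right_transporter_def m_assoc[symmetric] subset_iff)
qed (rule ring_axioms)

lemma ideal_prod_subset_iff:
  assumes "additive_subgroup Q R"
  shows "A \<cdot>\<^bsub>R\<^esub> B \<subseteq> Q \<longleftrightarrow> (\<forall>x\<in>A. \<forall>y\<in>B. x \<otimes>\<^bsub>R\<^esub> y \<in> Q)"
proof
  show "\<forall>x\<in>A. \<forall>y\<in>B. x \<otimes>\<^bsub>R\<^esub> y \<in> Q" if "A \<cdot>\<^bsub>R\<^esub> B \<subseteq> Q"
    using that ideal_prod.prod[of _ A _ B R] by (simp add: subset_iff)
next
  assume prods: "\<forall>x\<in>A. \<forall>y\<in>B. x \<otimes>\<^bsub>R\<^esub> y \<in> Q"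
  show "A \<cdot>\<^bsub>R\<^esub> B \<subseteq> Q"
  proof
    fix z assume "z \<in> A \<cdot>\<^bsub>R\<^esub> B"
    then show "z \<in> Q"
      by induction (simp_all add: prods additive_subgroup.a_closed[OF assms])
  qed
qed

lemma (in ring) middle_carrier_subset_iff_left_transporter:
  assumes "a \<in> carrier R" "b \<in> carrier R"
  shows "(a <# carrier R) #> b \<subseteq> Q \<longleftrightarrow> a \<in> left_transporter R (carrier R #> b) Q"
  using assms by (auto simp: l_coset_def r_coset_def left_transporter_def m_assoc)

lemma (in ring) middle_carrier_subset_iff_right_transporter:
  assumes "a \<in> carrier R" "b \<in> carrier R"
  shows "(a <# carrier R) #> b \<subseteq> Q \<longleftrightarrow> b \<in> right_transporter R (a <# carrier R) Q"
  using assms by (auto simp: l_coset_def r_coset_def right_transporter_def)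

lemma l_coset_subset_iff_left_transporter:
  assumes "a \<in> carrier R"
  shows "a <#\<^bsub>R\<^esub> J \<subseteq> Q \<longleftrightarrow> a \<in> left_transporter R J Q"
  using assms by (auto simp: l_coset_def left_transporter_def)

lemma (in ring) ideal_prod_subset_iff_left_transporter:
  assumes "A \<subseteq> carrier R" "additive_subgroup Q R"
  shows "A \<cdot> J \<subseteq> Q \<longleftrightarrow> A \<subseteq> left_transporter R J Q"
  using assms by (auto simp: ideal_prod_subset_iff left_transporter_def)

lemma (in ring) middle_carrier_subset_ideal_prod:
  assumes "ideal A R" "ideal B R" "a \<in> A" "b \<in> B"
  shows "(a <# carrier R) #> b \<subseteq> A \<cdot> B"
  using ideal.I_r_closed[OF assms(1,3)] assms(4)
  by (auto simp: l_coset_def r_coset_def intro: ideal_prod.prod)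

text \<open>
  The elements \<open>x\<close> with \<open>xRb \<subseteq> Q\<close> form an ideal, so \<open>a\<close> can be replaced by any element of
  \<open>\<langle>a\<rangle>\<close>; symmetrically for \<open>b\<close> afterwards.
\<close>

lemma (in ring) genideal_prod_subset:
  assumes a: "a \<in> carrier R" and b: "b \<in> carrier R" and Q: "ideal Q R"
    and aRb: "(a <# carrier R) #> b \<subseteq> Q"
  shows "(Idl {a}) \<cdot> (Idl {b}) \<subseteq> Q"
proof -
  interpret Q: ideal Q R by fact
  have Rb: "ideal (left_transporter R (carrier R #> b) Q) R"
    using b by (intro ideal_left_transporter Q) (auto simp: r_coset_def m_assoc[symmetric])
  have "a \<in> left_transporter R (carrier R #> b) Q"
    using aRb a b by (simp add: middle_carrier_subset_iff_left_transporter)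
  then have Idl_a: "Idl {a} \<subseteq> left_transporter R (carrier R #> b) Q"
    using genideal_minimal[OF Rb] by simp
  have "x \<otimes> y \<in> Q" if x: "x \<in> Idl {a}" and y: "y \<in> Idl {b}" for x y
  proof -
    have xR: "x \<in> carrier R" using x Idl_a by (auto simp: left_transporter_def)
    have ideal_xR: "ideal (right_transporter R (x <# carrier R) Q) R"
      using xR by (intro ideal_right_transporter Q) (auto simp: l_coset_def m_assoc)
    have "b \<in> right_transporter R (x <# carrier R) Q"
      using x Idl_a middle_carrier_subset_iff_left_transporter[OF xR b]
        middle_carrier_subset_iff_right_transporter[OF xR b] by blast
    then have "y \<in> right_transporter R (x <# carrier R) Q"
      using genideal_minimal[OF ideal_xR] y by auto
    moreover have "x \<otimes> \<one> \<in> x <# carrier R"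
      unfolding l_coset_def by blast
    then have "x \<in> x <# carrier R" using xR by simp
    ultimately show ?thesis by (auto simp: right_transporter_def)
  qed
  then show ?thesis
    by (simp add: ideal_prod_subset_iff[OF Q.additive_subgroup_axioms])
qed

text \<open>
  For fixed \<open>y\<close>, both \<open>H\<close> and the set of all \<open>x\<close> with \<open>xRy \<subseteq> Q\<close> are groups, so if they cover \<open>A\<close>, one
  of them contains it. Applied first to \<open>A\<close>, for \<open>y\<close> outside \<open>H\<close>, and then with the roles exchanged
  to \<open>B\<close>, this removes the restriction to elements outside \<open>H\<close>.
\<close>

lemma (in ring) ideal_prod_subset_if_outside_subgroup:
  assumes A: "ideal A R" and B: "ideal B R" and Q: "additive_subgroup Q R"
    and H: "additive_subgroup H R" and AH: "\<not> A \<subseteq> H" and BH: "\<not> B \<subseteq> H"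
    and outside: "\<And>x y. x \<in> A - H \<Longrightarrow> y \<in> B - H \<Longrightarrow> (x <# carrier R) #> y \<subseteq> Q"
  shows "A \<cdot> B \<subseteq> Q"
proof -
  interpret A: ideal A R by fact
  interpret B: ideal B R by fact
  have half: "(x <# carrier R) #> y \<subseteq> Q" if x: "x \<in> A" and y: "y \<in> B - H" for x y
  proof -
    have yR: "y \<in> carrier R" using y B.a_subset by blast
    let ?K = "left_transporter R (carrier R #> y) Q"
    have "additive_subgroup ?K R"
      using yR by (intro additive_subgroup_left_transporter Q) (auto simp: r_coset_def)
    moreover have "A \<subseteq> H \<union> ?K"
    proof
      fix z assume z: "z \<in> A"
      then show "z \<in> H \<union> ?K"
        using outside[of z y] y middle_carrier_subset_iff_left_transporter[OF A.Icarr[OF z] yR]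
        by blast
    qed
    ultimately have "A \<subseteq> ?K"
      using additive_subgroup_not_union[OF A.additive_subgroup_axioms H _ _ AH] by simp
    then show ?thesis
      using x middle_carrier_subset_iff_left_transporter[OF A.Icarr[OF x] yR] by blast
  qed
  have full: "(x <# carrier R) #> y \<subseteq> Q" if x: "x \<in> A" and y: "y \<in> B" for x y
  proof -
    have xR: "x \<in> carrier R" using x A.a_subset by blast
    let ?K = "right_transporter R (x <# carrier R) Q"
    have "additive_subgroup ?K R"
      using xR by (intro additive_subgroup_right_transporter Q) (auto simp: l_coset_def)
    moreover have "B \<subseteq> H \<union> ?K"
    proof
      fix z assume z: "z \<in> B"
      then show "z \<in> H \<union> ?K"
        using half[OF x, of z] middle_carrier_subset_iff_right_transporter[OF xR B.Icarr[OF z]]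
        by blast
    qed
    ultimately have "B \<subseteq> ?K"
      using additive_subgroup_not_union[OF B.additive_subgroup_axioms H _ _ BH] by simp
    then show ?thesis
      using y middle_carrier_subset_iff_right_transporter[OF xR B.Icarr[OF y]] by blast
  qed
  have "x \<otimes> y \<in> Q" if x: "x \<in> A" and y: "y \<in> B" for x y
  proof -
    have "x \<in> carrier R" using x A.a_subset by blast
    moreover have "x \<otimes> \<one> \<otimes> y \<in> (x <# carrier R) #> y"
      unfolding l_coset_def r_coset_def by blast
    ultimately have "x \<otimes> y \<in> (x <# carrier R) #> y" by simp
    then show ?thesis using full[OF x y] by blast
  qed
  then show ?thesis by (simp add: ideal_prod_subset_iff[OF Q])
qed

theorem theorem3p6:
  fixes R :: "('a, 'b) ring_scheme" and S P :: "'a set"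
  assumes "ring R"
    and "m_system R S"
    and "ideal P R"
    and "P \<inter> S = {}"
  shows "almost_right_S_prime R S P \<longleftrightarrow>
    (\<exists>s\<in>S. \<forall>a\<in>carrier R. \<forall>b\<in>carrier R.
       (a <#\<^bsub>R\<^esub> carrier R) #>\<^bsub>R\<^esub> b \<subseteq> P \<longrightarrow>
       \<not> (a <#\<^bsub>R\<^esub> carrier R) #>\<^bsub>R\<^esub> b \<subseteq> P \<cdot>\<^bsub>R\<^esub> P \<longrightarrow>
       a <#\<^bsub>R\<^esub> (Idl\<^bsub>R\<^esub> {s}) \<subseteq> P \<or> b <#\<^bsub>R\<^esub> (Idl\<^bsub>R\<^esub> {s}) \<subseteq> P)"
proof -
  interpret ring R by fact
  interpret P: ideal P R by fact
  have PP: "additive_subgroup (P \<cdot>\<^bsub>R\<^esub> P) R"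
    using ideal_prod_is_ideal[OF assms(3) assms(3)] by (rule ideal.axioms(1))
  have S: "S \<subseteq> carrier R" using assms(2) by (simp add: m_system_def)
  show ?thesis
  proof
    assume "almost_right_S_prime R S P"
    then obtain s where s: "s \<in> S" and prime: "\<And>A B. ideal A R \<Longrightarrow> ideal B R \<Longrightarrow>
        A \<cdot>\<^bsub>R\<^esub> B \<subseteq> P \<Longrightarrow> \<not> A \<cdot>\<^bsub>R\<^esub> B \<subseteq> P \<cdot>\<^bsub>R\<^esub> P \<Longrightarrow>
        A \<cdot>\<^bsub>R\<^esub> (Idl\<^bsub>R\<^esub> {s}) \<subseteq> P \<or> B \<cdot>\<^bsub>R\<^esub> (Idl\<^bsub>R\<^esub> {s}) \<subseteq> P"
      unfolding almost_right_S_prime_def by blast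
    show "\<exists>s\<in>S. \<forall>a\<in>carrier R. \<forall>b\<in>carrier R.
       (a <#\<^bsub>R\<^esub> carrier R) #>\<^bsub>R\<^esub> b \<subseteq> P \<longrightarrow>
       \<not> (a <#\<^bsub>R\<^esub> carrier R) #>\<^bsub>R\<^esub> b \<subseteq> P \<cdot>\<^bsub>R\<^esub> P \<longrightarrow>
       a <#\<^bsub>R\<^esub> (Idl\<^bsub>R\<^esub> {s}) \<subseteq> P \<or> b <#\<^bsub>R\<^esub> (Idl\<^bsub>R\<^esub> {s}) \<subseteq> P"
    proof (intro bexI[OF _ s] ballI impI)
      fix a b assume a: "a \<in> carrier R" and b: "b \<in> carrier R"
        and aRb: "(a <#\<^bsub>R\<^esub> carrier R) #>\<^bsub>R\<^esub> b \<subseteq> P"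
        and not_PP: "\<not> (a <#\<^bsub>R\<^esub> carrier R) #>\<^bsub>R\<^esub> b \<subseteq> P \<cdot>\<^bsub>R\<^esub> P"
      have ideals: "ideal (Idl\<^bsub>R\<^esub> {a}) R" "ideal (Idl\<^bsub>R\<^esub> {b}) R"
        using a b by (auto intro: genideal_ideal)
      have self: "a \<in> Idl\<^bsub>R\<^esub> {a}" "b \<in> Idl\<^bsub>R\<^esub> {b}"
        using a b by (auto intro: genideal_self')
      have "\<not> (Idl\<^bsub>R\<^esub> {a}) \<cdot>\<^bsub>R\<^esub> (Idl\<^bsub>R\<^esub> {b}) \<subseteq> P \<cdot>\<^bsub>R\<^esub> P"
        using middle_carrier_subset_ideal_prod[OF ideals self] not_PP by blast
      then have "(Idl\<^bsub>R\<^esub> {a}) \<cdot>\<^bsub>R\<^esub> (Idl\<^bsub>R\<^esub> {s}) \<subseteq> P \<or> (Idl\<^bsub>R\<^esub> {b}) \<cdot>\<^bsub>R\<^esub> (Idl\<^bsub>R\<^esub> {s}) \<subseteq> P"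
        using prime[OF ideals genideal_prod_subset[OF a b assms(3) aRb]] by blast
      then show "a <#\<^bsub>R\<^esub> (Idl\<^bsub>R\<^esub> {s}) \<subseteq> P \<or> b <#\<^bsub>R\<^esub> (Idl\<^bsub>R\<^esub> {s}) \<subseteq> P"
        using self a b
        by (auto simp: ideal_prod_subset_iff[OF P.additive_subgroup_axioms] l_coset_def)
    qed
  next
    assume "\<exists>s\<in>S. \<forall>a\<in>carrier R. \<forall>b\<in>carrier R.
       (a <#\<^bsub>R\<^esub> carrier R) #>\<^bsub>R\<^esub> b \<subseteq> P \<longrightarrow>
       \<not> (a <#\<^bsub>R\<^esub> carrier R) #>\<^bsub>R\<^esub> b \<subseteq> P \<cdot>\<^bsub>R\<^esub> P \<longrightarrow>
       a <#\<^bsub>R\<^esub> (Idl\<^bsub>R\<^esub> {s}) \<subseteq> P \<or> b <#\<^bsub>R\<^esub> (Idl\<^bsub>R\<^esub> {s}) \<subseteq> P"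
    then obtain s where s: "s \<in> S" and elem: "\<And>a b. a \<in> carrier R \<Longrightarrow> b \<in> carrier R \<Longrightarrow>
       (a <#\<^bsub>R\<^esub> carrier R) #>\<^bsub>R\<^esub> b \<subseteq> P \<Longrightarrow>
       \<not> (a <#\<^bsub>R\<^esub> carrier R) #>\<^bsub>R\<^esub> b \<subseteq> P \<cdot>\<^bsub>R\<^esub> P \<Longrightarrow>
       a <#\<^bsub>R\<^esub> (Idl\<^bsub>R\<^esub> {s}) \<subseteq> P \<or> b <#\<^bsub>R\<^esub> (Idl\<^bsub>R\<^esub> {s}) \<subseteq> P"
      by blast
    let ?J = "Idl\<^bsub>R\<^esub> {s}"
    let ?H = "left_transporter R ?J P"
    have "ideal ?J R" using s S by (intro genideal_ideal) auto
    then have "?J \<subseteq> carrier R" by (intro additive_subgroup.a_subset ideal.axioms(1))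
    then have H: "additive_subgroup ?H R"
      by (intro additive_subgroup_left_transporter P.additive_subgroup_axioms)
    have "A \<cdot>\<^bsub>R\<^esub> ?J \<subseteq> P \<or> B \<cdot>\<^bsub>R\<^esub> ?J \<subseteq> P"
      if A: "ideal A R" and B: "ideal B R" and AB: "A \<cdot>\<^bsub>R\<^esub> B \<subseteq> P"
        and not_PP: "\<not> A \<cdot>\<^bsub>R\<^esub> B \<subseteq> P \<cdot>\<^bsub>R\<^esub> P" for A B
    proof (rule ccontr)
      interpret A: ideal A R by fact
      interpret B: ideal B R by fact
      assume "\<not> (A \<cdot>\<^bsub>R\<^esub> ?J \<subseteq> P \<or> B \<cdot>\<^bsub>R\<^esub> ?J \<subseteq> P)"
      then have AH: "\<not> A \<subseteq> ?H" and BH: "\<not> B \<subseteq> ?H"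
        using ideal_prod_subset_iff_left_transporter[OF A.a_subset P.additive_subgroup_axioms]
          ideal_prod_subset_iff_left_transporter[OF B.a_subset P.additive_subgroup_axioms]
        by blast+
      have "A \<cdot>\<^bsub>R\<^esub> B \<subseteq> P \<cdot>\<^bsub>R\<^esub> P"
      proof (rule ideal_prod_subset_if_outside_subgroup[OF A B PP H AH BH])
        fix x y assume x: "x \<in> A - ?H" and y: "y \<in> B - ?H"
        have carr: "x \<in> carrier R" "y \<in> carrier R"
          using x y A.a_subset B.a_subset by auto
        have "(x <#\<^bsub>R\<^esub> carrier R) #>\<^bsub>R\<^esub> y \<subseteq> P"
          using middle_carrier_subset_ideal_prod[OF A B] x y AB by blast
        then show "(x <#\<^bsub>R\<^esub> carrier R) #>\<^bsub>R\<^esub> y \<subseteq> P \<cdot>\<^bsub>R\<^esub> P"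
          using elem[OF carr] x y carr by (auto simp: l_coset_subset_iff_left_transporter)
      qed
      then show False using not_PP by blast
    qed
    then show "almost_right_S_prime R S P"
      unfolding almost_right_S_prime_def using assms(3,4) s by blast
  qed
qed

end
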